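(* Let $n$ be a positive integer. For each integer $r$ with $0\le r\le \lfloor n/2\rfloor$, let $s=n-2r$, and for partitions $\theta_1\vdash r$ and $\theta_2\vdash s$ let $d_r(\mu,\theta)$ be the derived composition of the $\mu$-multipartition $\theta=(\theta_1,\theta_2)$, where $\mu=(r,s)$. Let $\mathcal{M}_n$ be the set of all positive integers $m$ for which there exists a linear operator $T$ on $\mathbb{R}^n$ such that $\mathbb{R}^n$ has exactly $m$ $T$-invariant subspaces. Then $$\mathcal{M}_n=\left\{\prod_{i=1}^{\ell(d_r(\mu,\theta))}\bigl(d_r(\mu,\theta)_i+1\bigr)\ \middle|\ 0\le r\le \lfloor n/2\rfloor,\ \mu=(r,n-2r),\ \theta=(\theta_1,\theta_2),\ \theta_1\vdash r,\ \theta_2\vdash n-2r\right\}.$$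
   Context: A linear operator on $\mathbb{R}^n$ is an $\mathbb{R}$-linear map $T:\mathbb{R}^n\to\mathbb{R}^n$. A subspace $W$ of $\mathbb{R}^n$ is $T$-invariant if $T(W)\subseteq W$; the zero subspace and $\mathbb{R}^n$ itself count as $T$-invariant subspaces. A composition is a finite ordered list $\mu=(\mu_1,\ldots,\mu_q)$ of nonnegative integers, called its parts, in which $0$ appears at most once; it is a composition of $\sum_i\mu_i$. Its length is $\ell(\mu)=q$, and $\mu_i$ denotes its $i$-th part. A partition of a positive integer $N$, written $\theta\vdash N$, is a composition of $N$ all of whose parts are positive and weakly decreasing from left to right. For $N=0$ the only partition is taken to be $(0)$ (so it contributes a factor $0+1=1$ to the product). Given $\mu=(\mu_1,\ldots,\mu_q)$, a $\mu$-multipartition is an ordered list $\theta=(\theta_1,\ldots,\theta_q)$ of partitions with $\theta_i\vdash\mu_i$ for each $i$. Its derived composition $d(\mu,\theta)$ is the composition obtained by concatenating $\theta_1,\ldots,\theta_q$ (removing the internal parentheses). For example, if $\mu=(5,6,3)$ and $\theta=((4,1),(3,2,1),(2,1))$, then $d(\mu,\theta)=(4,1,3,2,1,2,1)$. For $\mu=(r,s)$ with $s=n-2r$, the derived composition is written $d_r(\mu,\theta)$. *)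

theory Defs
  imports "HOL-Analysis.Analysis"
begin

definition invariant_subspaces :: "('a::real_vector \<Rightarrow> 'a) \<Rightarrow> 'a set set" where
  "invariant_subspaces T = {W. subspace W \<and> T ` W \<subseteq> W}"

definition composition :: "nat list \<Rightarrow> bool" where
  "composition \<mu> \<longleftrightarrow> count_list \<mu> 0 \<le> 1"

(* The only partition of 0 is [0]; in particular the empty list is not a partition. *)
definition partition_of :: "nat list \<Rightarrow> nat \<Rightarrow> bool" where
  "partition_of \<theta> N \<longleftrightarrow>
     (if N = 0 then \<theta> = [0]
      else composition \<theta> \<and> sum_list \<theta> = N \<and> (\<forall>k \<in> set \<theta>. k > 0) \<and> sorted_wrt (\<ge>) \<theta>)"

definition multipartition :: "nat list \<Rightarrow> nat list list \<Rightarrow> bool" where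
  "multipartition \<mu> \<theta> \<longleftrightarrow> composition \<mu> \<and> list_all2 partition_of \<theta> \<mu>"

(* The value depends only on \<theta>: the composition \<mu> is recovered from the sums of its entries. *)
definition derived_composition :: "nat list \<Rightarrow> nat list list \<Rightarrow> nat list" where
  "derived_composition \<mu> \<theta> = concat \<theta>"

end

theory Submission
  imports
    Defs
    "HOL-Computational_Algebra.Polynomial_Factorial"
    "HOL-Computational_Algebra.Field_as_Ring"
    "HOL-Computational_Algebra.Fundamental_Theorem_Algebra"
begin

text \<open>
  The number of invariant subspaces of an operator is finite only if the operator is cyclic: every
  vector \<open>v\<close> lies in the invariant subspace \<open>\<real>[x] v\<close> of all \<open>p(T) v\<close>, so finitely many invariant
  subspaces yield a cover of \<open>\<real>\<^sup>n\<close> by finitely many subspaces of this kind, and a real vector space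
  is not a finite union of proper subspaces. Hence some \<open>\<real>[x] v\<close> is the whole space
  (\<open>cyclic_presentation_exists\<close>).

  For a cyclic vector \<open>v\<close> the map \<open>p \<mapsto> p(T) v\<close> presents \<open>\<real>\<^sup>n\<close> as \<open>\<real>[x]/(f)\<close>, with \<open>T\<close> acting as
  multiplication by \<open>x\<close> and \<open>f\<close> of degree \<open>n\<close>. Invariant subspaces then are the ideals of \<open>\<real>[x]\<close>
  containing \<open>f\<close>, that is, the monic divisors of \<open>f\<close>
  (\<open>bij_betw_divisors_invariant_subspaces\<close>). Conversely every polynomial of degree \<open>n\<close> arises in
  this way, from multiplication by \<open>x\<close> on \<open>\<real>[x]/(f)\<close> (\<open>cyclic_presentation_of_poly\<close>).

  It remains to determine the possible numbers of monic divisors. If \<open>f\<close> is, up to a unit, a product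
  of distinct monic primes \<open>p\<close> with exponents \<open>k p\<close>, the number is the product of all \<open>k p + 1\<close>. Real
  primes have degree 1 or 2, so the exponents of the quadratic ones form a partition of some \<open>r\<close> and
  those of the linear ones a partition of \<open>n - 2 r\<close> (\<open>card_divisors_imp_partitions\<close>). Since there
  are infinitely many monic primes of either degree, all pairs of partitions occur
  (\<open>partitions_imp_card_divisors\<close>).
\<close>

section \<open>Ideals, primes and divisors of real polynomials\<close>

text \<open>
  Division with remainder by a nonzero element of minimal degree, made monic by \<open>normalize\<close>.
\<close>
lemma ideal_generator:
  fixes I :: "real poly set"
  assumes diff: "\<And>p q. p \<in> I \<Longrightarrow> q \<in> I \<Longrightarrow> p - q \<in> I"
    and mult: "\<And>p q. p \<in> I \<Longrightarrow> q * p \<in> I"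
    and nz: "f \<in> I" "f \<noteq> 0"
  shows "\<exists>d. normalize d = d \<and> d \<noteq> 0 \<and> I = {p. d dvd p}"
proof -
  define g where "g = arg_min degree (\<lambda>p. p \<in> I \<and> p \<noteq> 0)"
  have g: "g \<in> I" "g \<noteq> 0" and min: "\<And>p. p \<in> I \<Longrightarrow> p \<noteq> 0 \<Longrightarrow> degree g \<le> degree p"
    using arg_min_nat_lemma[of "\<lambda>p. p \<in> I \<and> p \<noteq> 0" f degree] nz unfolding g_def by auto
  have "g dvd p" if "p \<in> I" for p
  proof (rule ccontr)
    assume ndvd: "\<not> g dvd p"
    have "p - p div g * g \<in> I" using that g diff mult by blast
    hence "p mod g \<in> I" by (simp add: minus_div_mult_eq_mod)
    moreover have "p mod g \<noteq> 0" using ndvd by (simp add: mod_eq_0_iff_dvd)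
    ultimately show False using min degree_mod_less_degree[OF g(2) ndvd] by fastforce
  qed
  moreover have "p \<in> I" if "g dvd p" for p
    using that mult[OF g(1)] by (auto simp: dvd_def mult.commute)
  ultimately have "I = {p. normalize g dvd p}" by auto
  thus ?thesis using g by (intro exI[of _ "normalize g"]) auto
qed

text \<open>
  By the fundamental theorem of algebra a complex root \<open>z\<close> exists. Its minimal polynomial over \<open>\<real>\<close>,
  which is \<open>x - z\<close> or \<open>(x - z) (x - cnj z)\<close>, divides \<open>p\<close>, and so is associated to \<open>p\<close>.
\<close>
lemma prime_real_poly_degree:
  fixes p :: "real poly"
  assumes "prime p"
  shows "degree p = 1 \<or> degree p = 2"
proof -
  have p0: "p \<noteq> 0" and irr: "irreducible p"
    using assms by (auto intro: prime_elem_imp_irreducible)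
  have deg: "degree p \<noteq> 0"
    using assms p0 by (metis is_unit_iff_degree not_prime_unit)
  let ?c = "\<lambda>q. map_poly complex_of_real q"
  have c_add: "?c (q + r) = ?c q + ?c r" for q r
    by (intro poly_eqI) (simp add: coeff_map_poly)
  have c_smult: "?c (smult a r) = smult (of_real a) (?c r)" for a r
    by (intro poly_eqI) (simp add: coeff_map_poly)
  have c_mult: "?c (q * r) = ?c q * ?c r" for q r
    by (induction q) (simp_all add: c_add c_smult map_poly_pCons)
  have "degree (?c p) = degree p" by (intro map_poly_degree_eq) (simp add: p0)
  then obtain z where z: "poly (?c p) z = 0"
    using fundamental_theorem_of_algebra[of "?c p"] deg constant_degree[of "?c p"] by auto
  define q where "q = (if Im z = 0 then [:- Re z, 1:] else [:(Re z)\<^sup>2 + (Im z)\<^sup>2, - 2 * Re z, 1:])"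
  have qz: "poly (?c q) z = 0"
    by (auto simp: q_def map_poly_pCons complex_eq_iff power2_eq_square algebra_simps)
  have degq: "degree q = 1 \<or> degree q = 2" by (simp add: q_def)
  hence q0: "q \<noteq> 0" by auto
  define r where "r = p mod q"
  have rz: "poly (?c r) z = 0"
  proof -
    have "?c p = ?c q * ?c (p div q) + ?c r"
      unfolding r_def by (metis c_add c_mult mult_div_mod_eq)
    thus ?thesis using z qz by simp
  qed
  \<comment> \<open>A real polynomial of degree below \<open>degree q\<close> vanishing at \<open>z\<close> is zero: compare real and
    imaginary parts.\<close>
  have "r = 0"
  proof (cases "Im z = 0")
    case True
    have "degree r = 0 \<or> r = 0"
      using degree_mod_less[OF q0, of p] True by (auto simp: r_def q_def)
    then obtain a where "r = [:a:]" by (metis degree_eq_zeroE pCons_0_0)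
    thus ?thesis using rz by (simp add: map_poly_pCons)
  next
    case False
    have "degree r < 2 \<or> r = 0"
      using degree_mod_less[OF q0, of p] False by (auto simp: r_def q_def)
    hence "r = [:coeff r 0, coeff r 1:]"
      by (intro poly_eqI) (auto simp: coeff_pCons coeff_eq_0 split: nat.splits)
    then obtain a b where r: "r = [:a, b:]" by blast
    hence "a + b * Re z = 0" "b * Im z = 0"
      using rz by (auto simp: map_poly_pCons complex_eq_iff algebra_simps)
    thus ?thesis using r False by auto
  qed
  hence "q dvd p" by (simp add: r_def mod_eq_0_iff_dvd)
  moreover have "\<not> is_unit q" using degq q0 by (auto simp: is_unit_iff_degree)
  ultimately have "p dvd q" using irr by (auto simp: irreducible_altdef)
  with \<open>q dvd p\<close> have "degree p = degree q"
    using p0 q0 by (intro antisym dvd_imp_degree_le)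
  thus ?thesis using degq by simp
qed

text \<open>
  A prime divisor of smaller degree would be linear and provide a root of \<open>p\<close>.
\<close>
lemma monic_real_poly_prime:
  fixes p :: "real poly"
  assumes "lead_coeff p = 1" and "degree p = 1 \<or> degree p = 2 \<and> (\<forall>x. poly p x \<noteq> 0)"
  shows "prime p"
proof -
  have p0: "p \<noteq> 0" using assms(1) by auto
  have norm_p: "normalize p = p" by (intro poly_eqI) (simp add: assms(1))
  have "\<not> is_unit p" using assms(2) p0 by (auto simp: is_unit_iff_degree)
  then obtain q where q: "prime q" "q dvd p" using prime_divisor_exists[of p] p0 by blast
  have "degree q = degree p"
  proof (rule ccontr)
    assume "degree q \<noteq> degree p"
    with dvd_imp_degree_le[OF q(2) p0] prime_real_poly_degree[OF q(1)] assms(2)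
    have "degree q = 1" and noroot: "\<And>x. poly p x \<noteq> 0" by auto
    moreover from \<open>degree q = 1\<close> have "q = [:coeff q 0, coeff q 1:]"
      by (intro poly_eqI) (auto simp: coeff_pCons coeff_eq_0 split: nat.splits)
    ultimately obtain a b where "q = [:a, b:]" "b \<noteq> 0"
      by (metis degree_pCons_0 pCons_0_0 zero_neq_one)
    hence "poly q (- a / b) = 0" by simp
    with q(2) have "poly p (- a / b) = 0" by (auto elim: dvdE)
    thus False using noroot by blast
  qed
  moreover obtain c where c: "p = q * c" using q(2) by (elim dvdE)
  ultimately have "is_unit c" using p0 by (auto simp: degree_mult_eq is_unit_iff_degree)
  hence "normalize p = normalize q" by (simp add: c normalize_mult_unit_right)
  thus ?thesis using norm_p q(1) normalize_prime[of q] by simp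
qed

text \<open>
  Unique factorisation: a normalized divisor is determined by its exponents, and these range freely
  over the families bounded by \<open>k\<close>.
\<close>
lemma card_divisors_prod_prime_powers:
  fixes S :: "'a :: {factorial_semiring, normalization_semidom_multiplicative} set"
  assumes S: "finite S" "\<And>p. p \<in> S \<Longrightarrow> prime p"
  shows "card {d. d dvd (\<Prod>p\<in>S. p ^ k p) \<and> normalize d = d} = (\<Prod>p\<in>S. k p + 1)"
    and "finite {d. d dvd (\<Prod>p\<in>S. p ^ k p) \<and> normalize d = d}"
proof -
  let ?g = "\<lambda>e. \<Prod>p\<in>S. p ^ e p"
  let ?D = "{d. d dvd ?g k \<and> normalize d = d}"
  have nz: "?g e \<noteq> 0" for e using S by auto (metis not_prime_0)
  have mult_g: "multiplicity q (?g e) = (if q \<in> S then e q else 0)" if "prime q" for q e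
    using that S by (simp add: multiplicity_prod_prime_powers)
  have norm_g: "normalize (?g e) = ?g e" for e
  proof -
    have "normalize (?g e) = (\<Prod>p\<in>S. normalize (p ^ e p))"
      using S(1) by induction (simp_all add: normalize_mult)
    also have "\<dots> = ?g e"
      using S(2) by (intro prod.cong refl) (simp add: normalize_power normalize_prime)
    finally show ?thesis .
  qed
  have bij: "bij_betw ?g (\<Pi>\<^sub>E p\<in>S. {..k p}) ?D"
  proof (rule bij_betw_byWitness[where f' = "\<lambda>d. \<lambda>p\<in>S. multiplicity p d"])
    show "\<forall>e\<in>\<Pi>\<^sub>E p\<in>S. {..k p}. (\<lambda>p\<in>S. multiplicity p (?g e)) = e"
      using S mult_g by (auto simp: PiE_def extensional_def fun_eq_iff)
    show "\<forall>d\<in>?D. ?g (\<lambda>p\<in>S. multiplicity p d) = d"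
    proof
      fix d assume d: "d \<in> ?D"
      hence d0: "d \<noteq> 0" using nz[of k] by auto
      have "multiplicity q d \<le> multiplicity q (?g k)" for q
        using d nz by (intro dvd_imp_multiplicity_le) auto
      hence "multiplicity q d = 0" if "prime q" "q \<notin> S" for q
        using mult_g[OF that(1), of k] that by (metis le_zero_eq)
      hence "normalize (?g (\<lambda>p\<in>S. multiplicity p d)) = normalize d"
        by (intro multiplicity_eq_imp_eq d0 nz) (simp add: mult_g)
      thus "?g (\<lambda>p\<in>S. multiplicity p d) = d" using d norm_g by simp
    qed
    show "?g ` (\<Pi>\<^sub>E p\<in>S. {..k p}) \<subseteq> ?D"
      by (auto simp: norm_g intro!: prod_dvd_prod le_imp_power_dvd)
    show "(\<lambda>d. \<lambda>p\<in>S. multiplicity p d) ` ?D \<subseteq> (\<Pi>\<^sub>E p\<in>S. {..k p})"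
    proof (clarsimp simp: PiE_iff)
      fix d p assume "d dvd ?g k" "p \<in> S"
      thus "multiplicity p d \<le> k p"
        using dvd_imp_multiplicity_le[OF \<open>d dvd ?g k\<close> nz, of p] mult_g[of p k] S by simp
    qed
  qed
  show "card ?D = (\<Prod>p\<in>S. k p + 1)"
    using bij_betw_same_card[OF bij] S(1) by (simp add: card_PiE)
  show "finite ?D"
    using bij_betw_finite[OF bij] S(1) by (auto intro: finite_PiE)
qed

section \<open>Cyclic modules over the real polynomial ring\<close>

text \<open>
  The map \<open>ev\<close> exhibits the space, with \<open>x\<close> acting as \<open>T\<close>, as the \<open>\<real>[x]\<close>-module \<open>\<real>[x]/(f)\<close>.
\<close>
locale cyclic_presentation =
  fixes ev :: "real poly \<Rightarrow> 'a::real_vector" and T :: "'a \<Rightarrow> 'a" and f :: "real poly"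
  assumes ev_add: "ev (p + q) = ev p + ev q"
    and ev_smult: "ev (smult c p) = c *\<^sub>R ev p"
    and ev_shift: "ev (pCons 0 p) = T (ev p)"
    and ev_surj: "range ev = UNIV"
    and ev_eq_0_iff: "ev p = 0 \<longleftrightarrow> f dvd p"
    and f_nz: "f \<noteq> 0"
begin

lemma ev_0: "ev 0 = 0"
  using ev_smult[of 0 0] by simp

lemma ev_diff: "ev (p - q) = ev p - ev q"
  using ev_add[of "p - q" q] by (simp add: algebra_simps)

lemma ev_sum: "ev (sum g A) = (\<Sum>x\<in>A. ev (g x))"
  by (induction A rule: infinite_finite_induct) (simp_all add: ev_0 ev_add)

lemma ev_mod: "ev (p mod f) = ev p"
proof -
  have "ev (p - p mod f) = 0" unfolding ev_eq_0_iff by (rule dvd_minus_mod)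
  thus ?thesis by (simp add: ev_diff)
qed

text \<open>
  Invariant under \<open>T\<close> means closed under multiplication by \<open>x\<close>, hence under all of \<open>\<real>[x]\<close>.
\<close>
lemma ev_mult_mem:
  assumes W: "W \<in> invariant_subspaces T" and "ev p \<in> W"
  shows "ev (q * p) \<in> W"
proof (induction q)
  case 0
  thus ?case using W by (simp add: invariant_subspaces_def ev_0 subspace_0)
next
  case (pCons a q)
  have "ev (pCons a q * p) = a *\<^sub>R ev p + T (ev (q * p))"
    by (simp add: ev_add ev_smult ev_shift)
  thus ?case using W pCons.IH \<open>ev p \<in> W\<close>
    by (auto simp: invariant_subspaces_def intro!: subspace_add subspace_mul)
qed

text \<open>
  The correspondence theorem for quotients of the principal ideal domain \<open>\<real>[x]\<close>: the preimage of an
  invariant subspace is an ideal containing \<open>f\<close>, so it is generated by a unique normalized divisor.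
\<close>
lemma bij_betw_divisors_invariant_subspaces:
  "bij_betw (\<lambda>d. ev ` {p. d dvd p}) {d. d dvd f \<and> normalize d = d} (invariant_subspaces T)"
proof (rule bij_betw_imageI)
  show "inj_on (\<lambda>d. ev ` {p. d dvd p}) {d. d dvd f \<and> normalize d = d}"
  proof (rule inj_onI, clarify)
    have dvd: "d dvd e" if "d dvd f" and eq: "ev ` {p. d dvd p} = ev ` {p. e dvd p}" for d e
    proof -
      have "ev e \<in> ev ` {p. d dvd p}" unfolding eq by (intro imageI) simp
      then obtain p where p: "d dvd p" "ev e = ev p" by blast
      hence "f dvd e - p" by (simp add: ev_diff flip: ev_eq_0_iff)
      with \<open>d dvd f\<close> have "d dvd e - p" by (rule dvd_trans)
      thus "d dvd e" using p(1) by (simp add: dvd_diff_left_iff)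
    qed
    fix d e assume "d dvd f" "normalize d = d" "e dvd f" "normalize e = e"
      "ev ` {p. d dvd p} = ev ` {p. e dvd p}"
    thus "d = e" by (metis associatedI dvd)
  qed
  show "(\<lambda>d. ev ` {p. d dvd p}) ` {d. d dvd f \<and> normalize d = d} = invariant_subspaces T"
  proof (intro equalityI subsetI)
    fix W assume "W \<in> (\<lambda>d. ev ` {p. d dvd p}) ` {d. d dvd f \<and> normalize d = d}"
    then obtain d where W: "W = ev ` {p. d dvd p}" by blast
    have "subspace W"
      unfolding W
    proof (rule subspaceI)
      show "0 \<in> ev ` {p. d dvd p}" by (rule image_eqI[of _ _ 0]) (simp_all add: ev_0)
    next
      fix x y assume "x \<in> ev ` {p. d dvd p}" "y \<in> ev ` {p. d dvd p}"
      then obtain p q where "d dvd p" "d dvd q" "x = ev p" "y = ev q" by blast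
      thus "x + y \<in> ev ` {p. d dvd p}"
        by (intro image_eqI[of _ _ "p + q"]) (simp_all add: ev_add)
    next
      fix c x assume "x \<in> ev ` {p. d dvd p}"
      then obtain p where "d dvd p" "x = ev p" by blast
      thus "c *\<^sub>R x \<in> ev ` {p. d dvd p}"
        by (intro image_eqI[of _ _ "smult c p"]) (simp_all add: ev_smult dvd_smult)
    qed
    moreover have "T (ev p) \<in> W" if "d dvd p" for p
    proof -
      have "d dvd pCons 0 p" using dvd_mult[OF that, of "[:0, 1:]"] by simp
      thus ?thesis by (simp add: W image_iff) (metis ev_shift)
    qed
    ultimately show "W \<in> invariant_subspaces T"
      by (auto simp: invariant_subspaces_def W)
  next
    fix W assume W: "W \<in> invariant_subspaces T"
    hence sub: "subspace W" by (simp add: invariant_subspaces_def)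
    have "f \<in> ev -` W" using ev_eq_0_iff[of f] sub by (simp add: subspace_0)
    then obtain d where d: "normalize d = d" "ev -` W = {p. d dvd p}"
      using ideal_generator[of "ev -` W" f] f_nz ev_mult_mem[OF W] subspace_diff[OF sub]
      by (auto simp: ev_diff)
    have "ev ` (ev -` W) = W" using ev_surj by (simp add: image_vimage_eq)
    with d \<open>f \<in> ev -` W\<close> show "W \<in> (\<lambda>d. ev ` {p. d dvd p}) ` {d. d dvd f \<and> normalize d = d}"
      by (intro image_eqI[of _ _ d]) auto
  qed
qed

lemma ev_coeffs:
  assumes "degree p < N"
  shows "ev p = (\<Sum>i<N. coeff p i *\<^sub>R ev (monom 1 i))"
proof -
  have "p = (\<Sum>i<N. monom (coeff p i) i)"
    using assms poly_as_sum_of_monoms'[of p "N - 1"] lessThan_Suc_atMost[of "N - 1"] by simp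
  hence "ev p = (\<Sum>i<N. ev (smult (coeff p i) (monom 1 i)))"
    by (simp add: smult_monom flip: ev_sum)
  thus ?thesis by (simp only: ev_smult)
qed

end

lemma linear_relation_exists:
  fixes b :: "nat \<Rightarrow> 'a::euclidean_space"
  assumes "DIM('a) < N"
  shows "\<exists>c j. j < N \<and> c j \<noteq> 0 \<and> (\<Sum>i<N. c i *\<^sub>R b i) = 0"
proof (cases "inj_on b {..<N}")
  case True
  have "dependent (b ` {..<N})"
    using assms True by (intro dependent_biggerset) (simp add: card_image)
  then obtain u where u: "\<exists>v\<in>b ` {..<N}. u v \<noteq> 0" "(\<Sum>v\<in>b ` {..<N}. u v *\<^sub>R v) = 0"
    by (auto simp: dependent_finite)
  hence "(\<Sum>i<N. u (b i) *\<^sub>R b i) = 0" using True by (simp add: sum.reindex o_def)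
  with u(1) show ?thesis by (intro exI[of _ "u \<circ> b"]) auto
next
  case False
  then obtain i j where ij: "i < N" "j < N" "b i = b j" "i \<noteq> j" by (auto simp: inj_on_def)
  define c where "c l = (if l = i then 1 else if l = j then - 1 else (0::real))" for l
  have "(\<Sum>l<N. c l *\<^sub>R b l) = (\<Sum>l\<in>{i, j}. c l *\<^sub>R b l)"
    using ij by (intro sum.mono_neutral_right) (auto simp: c_def)
  also have "\<dots> = 0" using ij by (simp add: c_def)
  finally show ?thesis using ij(1) by (intro exI[of _ c] exI[of _ i]) (simp add: c_def)
qed

text \<open>
  The images of the monomials \<open>x\<^sup>i\<close> with \<open>i < degree f\<close> form a basis: a linear relation between them
  is a polynomial of degree below \<open>degree f\<close> in the ideal \<open>(f)\<close>, and reduction modulo \<open>f\<close> shows that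
  they span.
\<close>
lemma cyclic_presentation_degree:
  fixes ev :: "real poly \<Rightarrow> 'a::euclidean_space"
  assumes "cyclic_presentation ev T f"
  shows "degree f = DIM('a)"
proof -
  interpret cyclic_presentation ev T f by fact
  let ?N = "degree f"
  define b where "b i = ev (monom 1 i)" for i
  have unique: "c j = 0" if sum0: "(\<Sum>i<?N. c i *\<^sub>R b i) = 0" and "j < ?N" for c j
  proof -
    define p where "p = (\<Sum>i<?N. monom (c i) i)"
    have coeff: "coeff p i = (if i < ?N then c i else 0)" for i
      by (simp add: p_def coeff_sum sum.delta' if_distrib cong: if_cong)
    have "degree p < ?N" using that(2)
      by (intro degree_lessI) (auto simp: coeff)
    moreover have "ev p = 0"
      using ev_coeffs[OF \<open>degree p < ?N\<close>] sum0 by (simp add: coeff b_def)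
    hence "f dvd p" by (simp add: ev_eq_0_iff)
    ultimately have "p = 0" using dvd_imp_degree_le[of f p] by linarith
    thus "c j = 0" using coeff[of j] that by simp
  qed
  have le: "?N \<le> DIM('a)"
    using linear_relation_exists[of ?N b] unique by (meson not_le)
  have "span (b ` {..<?N}) = UNIV"
  proof -
    have "ev p \<in> span (b ` {..<?N})" for p
    proof (cases "?N = 0")
      case True
      hence "ev p = 0" using f_nz is_unit_iff_degree ev_eq_0_iff by (metis unit_imp_dvd)
      thus ?thesis by (simp add: span_zero)
    next
      case False
      hence "degree (p mod f) < ?N" using degree_mod_less'[OF f_nz, of p] by (metis degree_0 gr0I)
      hence "ev p = (\<Sum>i<?N. coeff (p mod f) i *\<^sub>R b i)"
        using ev_coeffs[of "p mod f" ?N] by (simp add: ev_mod b_def)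
      also have "\<dots> \<in> span (b ` {..<?N})"
        by (intro span_sum span_scale) (simp add: span_base)
      finally show ?thesis .
    qed
    thus ?thesis using ev_surj by (metis UNIV_eq_I rangeE surj_def)
  qed
  hence "DIM('a) \<le> card (b ` {..<?N})"
    using dim_le_card[of "UNIV :: 'a set" "b ` {..<?N}"] by simp
  also have "\<dots> \<le> ?N" using card_image_le[of "{..<?N}" b] by simp
  finally show ?thesis using le by simp
qed

section \<open>Operators with finitely many invariant subspaces are cyclic\<close>

text \<open>
  The vector \<open>p(T) v\<close>, evaluated by Horner's scheme, which makes the recursion over \<open>pCons\<close> immediate.
\<close>
definition cyclic_eval :: "('a::real_vector \<Rightarrow> 'a) \<Rightarrow> 'a \<Rightarrow> real poly \<Rightarrow> 'a" where
  "cyclic_eval T v p = fold_coeffs (\<lambda>a w. a *\<^sub>R v + T w) p 0"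

context
  fixes T :: "'a::real_vector \<Rightarrow> 'a"
  assumes T: "linear T"
begin

lemma cyclic_eval_pCons:
  "cyclic_eval T v (pCons a p) = a *\<^sub>R v + T (cyclic_eval T v p)"
  by (cases "p = 0 \<and> a = 0") (auto simp: cyclic_eval_def linear_0[OF T])

lemma cyclic_eval_0: "cyclic_eval T v 0 = 0"
  by (simp add: cyclic_eval_def)

lemma cyclic_eval_add: "cyclic_eval T v (p + q) = cyclic_eval T v p + cyclic_eval T v q"
  by (induction p q rule: poly_induct2)
     (simp_all add: cyclic_eval_pCons cyclic_eval_0 linear_add[OF T] scaleR_add_left)

lemma cyclic_eval_smult: "cyclic_eval T v (smult c p) = c *\<^sub>R cyclic_eval T v p"
  by (induction p)
     (simp_all add: cyclic_eval_pCons cyclic_eval_0 linear_scale[OF T] scaleR_add_right)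

lemma cyclic_eval_diff: "cyclic_eval T v (p - q) = cyclic_eval T v p - cyclic_eval T v q"
  using cyclic_eval_add[of v "p - q" q] by (simp add: algebra_simps)

lemma cyclic_eval_mult_eq_0:
  "cyclic_eval T v p = 0 \<Longrightarrow> cyclic_eval T v (q * p) = 0"
  by (induction q)
     (simp_all add: cyclic_eval_0 cyclic_eval_add cyclic_eval_smult cyclic_eval_pCons linear_0[OF T])

lemma range_cyclic_eval_invariant: "range (cyclic_eval T v) \<in> invariant_subspaces T"
proof -
  have "subspace (range (cyclic_eval T v))"
    unfolding subspace_def image_iff
    by (metis UNIV_I cyclic_eval_0 cyclic_eval_add cyclic_eval_smult rangeE)
  moreover have "T (cyclic_eval T v p) \<in> range (cyclic_eval T v)" for p
    using cyclic_eval_pCons[of v 0 p] by (metis add_0 rangeI scaleR_zero_left)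
  ultimately show ?thesis by (auto simp: invariant_subspaces_def)
qed

lemma mem_range_cyclic_eval: "v \<in> range (cyclic_eval T v)"
  using cyclic_eval_pCons[of v 1 0] by (simp add: cyclic_eval_0 linear_0[OF T] image_iff) metis

end

text \<open>
  Proper subspaces are Lebesgue null sets, and a finite union of null sets is null.
\<close>
lemma finite_cover_by_subspaces:
  fixes \<W> :: "'a::euclidean_space set set"
  assumes "finite \<W>" "\<And>W. W \<in> \<W> \<Longrightarrow> subspace W" "\<Union>\<W> = UNIV"
  shows "UNIV \<in> \<W>"
proof (rule ccontr)
  assume "UNIV \<notin> \<W>"
  have "negligible W" if "W \<in> \<W>" for W
  proof (rule negligible_lowdim)
    have "W \<noteq> UNIV" using that \<open>UNIV \<notin> \<W>\<close> by auto
    thus "dim W < DIM('a)"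
      using dim_eq_full[of W] dim_subset_UNIV[of W] span_eq_iff[of W] assms(2)[OF that] by force
  qed
  hence "negligible (\<Union>\<W>)" using \<open>finite \<W>\<close> by (intro negligible_Union)
  thus False by (simp add: assms(3))
qed

lemma cyclic_presentation_exists:
  fixes T :: "'a::euclidean_space \<Rightarrow> 'a"
  assumes T: "linear T" and fin: "finite (invariant_subspaces T)"
  shows "\<exists>ev f. cyclic_presentation ev T f"
proof -
  have "UNIV \<in> range (\<lambda>v. range (cyclic_eval T v))"
  proof (rule finite_cover_by_subspaces)
    show "finite (range (\<lambda>v. range (cyclic_eval T v)))"
      using fin by (rule finite_subset[rotated]) (auto intro: range_cyclic_eval_invariant[OF T])
    show "subspace W" if "W \<in> range (\<lambda>v. range (cyclic_eval T v))" for W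
      using that range_cyclic_eval_invariant[OF T] by (auto simp: invariant_subspaces_def)
    show "\<Union> (range (\<lambda>v. range (cyclic_eval T v))) = UNIV"
      using mem_range_cyclic_eval[OF T] by blast
  qed
  then obtain v where "UNIV = range (cyclic_eval T v)" by (rule imageE)
  hence surj: "range (cyclic_eval T v) = UNIV" by (rule sym)
  let ?ev = "cyclic_eval T v"
  let ?b = "\<lambda>i. ?ev (monom 1 i)"
  \<comment> \<open>The annihilator of \<open>v\<close> is nonzero: the vectors \<open>T\<^sup>i v\<close> with \<open>i \<le> DIM('a)\<close> are dependent.\<close>
  obtain g where g: "?ev g = 0" "g \<noteq> 0"
  proof -
    obtain c j where c: "j < Suc DIM('a)" "c j \<noteq> 0" "(\<Sum>i<Suc DIM('a). c i *\<^sub>R ?b i) = 0"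
      using linear_relation_exists[of "Suc DIM('a)" ?b] by blast
    define g where "g = (\<Sum>i<Suc DIM('a). smult (c i) (monom 1 i))"
    have "?ev (sum h A) = (\<Sum>i\<in>A. ?ev (h i))" for h and A :: "nat set"
      by (induction A rule: infinite_finite_induct)
         (simp_all add: cyclic_eval_0[OF T] cyclic_eval_add[OF T])
    hence ev_g: "?ev g = 0" using c(3) by (simp only: g_def cyclic_eval_smult[OF T])
    have "coeff g j = c j"
      using c(1) by (simp add: g_def smult_monom coeff_sum_monom lessThan_Suc_atMost del: sum.lessThan_Suc)
    hence "g \<noteq> 0" using c(2) by force
    with ev_g show ?thesis by (rule that)
  qed
  obtain f where f: "f \<noteq> 0" "?ev -` {0} = {p. f dvd p}"
    using ideal_generator[of "?ev -` {0}" g] g cyclic_eval_mult_eq_0[OF T]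
    by (auto simp: cyclic_eval_diff[OF T])
  have "cyclic_presentation ?ev T f"
    using f surj cyclic_eval_pCons[OF T, of v 0]
    by unfold_locales
       (auto simp: cyclic_eval_add[OF T] cyclic_eval_smult[OF T] set_eq_iff)
  thus ?thesis by blast
qed

section \<open>Every polynomial is realised by an operator\<close>

text \<open>
  Coordinates on \<open>\<real>[x]/(f)\<close> are the coefficients of the remainder modulo \<open>f\<close>; the operator is
  multiplication by \<open>x\<close>, its matrix being the companion matrix of the monic scalar multiple of \<open>f\<close> for a
  suitable order of the coordinates.
\<close>
lemma cyclic_presentation_of_poly:
  fixes f :: "real poly"
  assumes deg: "degree f = CARD('n::finite)"
  shows "\<exists>ev (T :: real ^ 'n \<Rightarrow> real ^ 'n). linear T \<and> cyclic_presentation ev T f"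
proof -
  have f0: "f \<noteq> 0" using deg by auto
  obtain e :: "'n \<Rightarrow> nat" where e: "bij_betw e UNIV {..<degree f}"
    using ex_bij_betw_finite_nat[of "UNIV :: 'n set"] deg by (auto simp: atLeast0LessThan)
  have e_less: "e i < degree f" for i using e by (auto simp: bij_betw_def)
  define ev :: "real poly \<Rightarrow> real ^ 'n" where "ev p = (\<chi> i. coeff (p mod f) (e i))" for p
  define lift :: "real ^ 'n \<Rightarrow> real poly" where "lift x = (\<Sum>i\<in>UNIV. monom (x $ i) (e i))" for x
  define T where "T x = ev (pCons 0 (lift x))" for x
  have ev_add: "ev (p + q) = ev p + ev q" for p q
    by (simp add: ev_def vec_eq_iff poly_mod_add_left)
  have ev_smult: "ev (smult c p) = c *\<^sub>R ev p" for c p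
    by (simp add: ev_def vec_eq_iff mod_smult_left)
  have coeff_lift: "coeff (lift x) (e i) = x $ i" for x i
  proof -
    have "coeff (lift x) (e i) = (\<Sum>j\<in>UNIV. if j = i then x $ j else 0)"
      using e by (auto simp: lift_def coeff_sum bij_betw_def inj_eq intro!: sum.cong)
    thus ?thesis by simp
  qed
  have coeff_lift_0: "coeff (lift x) k = 0" if "k \<ge> degree f" for x k
    using e_less that by (auto simp: lift_def coeff_sum not_less intro!: sum.neutral) (metis leD)
  have mod_coeff_0: "coeff (p mod f) k = 0" if "k \<ge> degree f" for p k
    using degree_mod_less[OF f0, of p] that by (auto intro: coeff_eq_0)
  have lift_ev: "lift (ev p) = p mod f" for p
  proof (rule poly_eqI)
    fix k show "coeff (lift (ev p)) k = coeff (p mod f) k"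
    proof (cases "k < degree f")
      case True
      then obtain i where "k = e i" using e by (auto simp: bij_betw_def image_iff set_eq_iff)
      thus ?thesis by (simp add: coeff_lift ev_def)
    next
      case False
      thus ?thesis by (simp add: coeff_lift_0 mod_coeff_0)
    qed
  qed
  have lift_mod: "lift x mod f = lift x" for x
  proof -
    have "degree (lift x) < degree f"
      using deg coeff_lift_0 by (intro degree_lessI) auto
    thus ?thesis by (rule mod_poly_less)
  qed
  have ev_lift: "ev (lift x) = x" for x
    by (simp add: ev_def lift_mod coeff_lift)
  have lift_add: "lift (x + y) = lift x + lift y" for x y
    by (simp add: lift_def sum.distrib flip: add_monom)
  have lift_scale: "lift (c *\<^sub>R x) = smult c (lift x)" for c x
    by (intro poly_eqI) (auto simp: lift_def coeff_sum sum_distrib_left intro!: sum.cong)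
  have "linear T"
  proof (rule linearI)
    show "T (x + y) = T x + T y" for x y
      using ev_add[of "pCons 0 (lift x)" "pCons 0 (lift y)"] by (simp add: T_def lift_add)
    show "T (c *\<^sub>R x) = c *\<^sub>R T x" for c x
      using ev_smult[of c "pCons 0 (lift x)"] by (simp add: T_def lift_scale)
  qed
  moreover have "cyclic_presentation ev T f"
  proof
    show "ev (pCons 0 p) = T (ev p)" for p
    proof -
      have "pCons 0 (p mod f) mod f = pCons 0 p mod f"
        using mod_mult_right_eq[of "[:0, 1:]" p f] by simp
      thus ?thesis by (simp add: T_def lift_ev) (simp add: ev_def)
    qed
    show "range ev = UNIV" using ev_lift by (metis surjI)
    show "ev p = 0 \<longleftrightarrow> f dvd p" for p
    proof
      assume "ev p = 0"
      hence "p mod f = lift 0" by (metis lift_ev)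
      thus "f dvd p" by (simp add: lift_def mod_eq_0_iff_dvd)
    next
      assume "f dvd p"
      thus "ev p = 0" by (simp add: ev_def vec_eq_iff mod_eq_0_iff_dvd[THEN iffD2])
    qed
  qed (use ev_add ev_smult f0 in auto)
  ultimately show ?thesis by blast
qed

section \<open>Divisor counts and pairs of partitions\<close>

text \<open>
  The case \<open>S = {}\<close> gives the partition \<open>[0]\<close>, whose factor \<open>0 + 1\<close> is the empty product.
\<close>
lemma partition_of_sum:
  assumes "finite S" "\<And>x. x \<in> S \<Longrightarrow> k x > 0"
  shows "\<exists>\<theta>. partition_of \<theta> (\<Sum>x\<in>S. k x) \<and> prod_list (map Suc \<theta>) = (\<Prod>x\<in>S. k x + 1)"
proof (cases "S = {}")
  case True
  thus ?thesis by (intro exI[of _ "[0]"]) (simp add: partition_of_def)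
next
  case False
  obtain xs where xs: "set xs = S" "distinct xs" using finite_distinct_list[OF assms(1)] by blast
  define \<theta> where "\<theta> = rev (sort (map k xs))"
  have m: "mset \<theta> = mset (map k xs)" by (simp add: \<theta>_def)
  have "sum_list \<theta> = sum_list (map k xs)" by (metis m sum_mset_sum_list)
  also have "\<dots> = (\<Sum>x\<in>S. k x)" using xs by (simp add: sum_list_distinct_conv_sum_set)
  finally have sum: "sum_list \<theta> = (\<Sum>x\<in>S. k x)" .
  have "prod_list (map Suc \<theta>) = prod_mset (image_mset Suc (mset \<theta>))"
    by (simp flip: prod_mset_prod_list)
  also have "\<dots> = prod_list (map (\<lambda>x. k x + 1) xs)"
    by (simp add: m image_mset.compositionality o_def flip: prod_mset_prod_list)
  also have "\<dots> = (\<Prod>x\<in>S. k x + 1)"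
    using xs by (simp flip: prod.distinct_set_conv_list)
  finally have prod: "prod_list (map Suc \<theta>) = (\<Prod>x\<in>S. k x + 1)" .
  have pos: "\<forall>i\<in>set \<theta>. i > 0" using assms(2) xs by (auto simp: \<theta>_def)
  hence "composition \<theta>" using count_list_0_iff[of \<theta> 0] by (auto simp: composition_def)
  moreover have "sorted_wrt (\<ge>) \<theta>" by (simp add: \<theta>_def sorted_wrt_rev)
  moreover have "(\<Sum>x\<in>S. k x) \<noteq> 0" 
    using False assms by (simp add: sum_eq_0_iff) (metis all_not_in_conv less_irrefl)
  ultimately have "partition_of \<theta> (\<Sum>x\<in>S. k x)"
    using sum pos by (simp add: partition_of_def)
  thus ?thesis using prod by blast
qed

text \<open>
  Taking degrees in the prime factorisation of \<open>f\<close> gives \<open>degree f = 2 r + s\<close>, where \<open>r\<close> and \<open>s\<close> are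
  the exponent sums of the quadratic and of the linear primes.
\<close>
lemma card_divisors_imp_partitions:
  fixes f :: "real poly"
  assumes "f \<noteq> 0"
  shows "\<exists>r s \<theta>1 \<theta>2. degree f = 2 * r + s \<and> partition_of \<theta>1 r \<and> partition_of \<theta>2 s \<and>
           card {d. d dvd f \<and> normalize d = d} = prod_list (map Suc (\<theta>1 @ \<theta>2))"
proof -
  let ?m = "\<lambda>p. multiplicity p f"
  define S where "S j = {p \<in> prime_factors f. degree p = j}" for j
  have un: "prime_factors f = S 2 \<union> S 1" and disj: "S 2 \<inter> S 1 = {}"
    using prime_real_poly_degree by (auto simp: S_def)
  have fin: "finite (S j)" for j by (simp add: S_def)
  have pos: "?m p > 0" if "p \<in> S j" for p j
    using that by (auto simp: S_def prime_factors_multiplicity)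
  have f: "normalize f = (\<Prod>p\<in>prime_factors f. p ^ ?m p)"
    using assms by (simp add: prod_prime_factors)
  have "degree f = degree (normalize f)"
    using assms by (intro antisym dvd_imp_degree_le) simp_all
  also have "\<dots> = (\<Sum>p\<in>prime_factors f. ?m p * degree p)"
    unfolding f by (subst degree_prod_sum_eq) (auto intro!: sum.cong degree_power_eq)
  also have "\<dots> = 2 * (\<Sum>p\<in>S 2. ?m p) + (\<Sum>p\<in>S 1. ?m p)"
    unfolding un sum.union_disjoint[OF fin fin disj]
    by (simp add: S_def sum_distrib_left mult.commute)
  finally have deg: "degree f = 2 * (\<Sum>p\<in>S 2. ?m p) + (\<Sum>p\<in>S 1. ?m p)" .
  have "card {d. d dvd f \<and> normalize d = d} = card {d. d dvd normalize f \<and> normalize d = d}"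
    by simp
  also have "\<dots> = (\<Prod>p\<in>prime_factors f. ?m p + 1)"
    unfolding f by (rule card_divisors_prod_prime_powers) auto
  also have "\<dots> = (\<Prod>p\<in>S 2. ?m p + 1) * (\<Prod>p\<in>S 1. ?m p + 1)"
    unfolding un by (rule prod.union_disjoint[OF fin fin disj])
  finally have card: "card {d. d dvd f \<and> normalize d = d} = (\<Prod>p\<in>S 2. ?m p + 1) * (\<Prod>p\<in>S 1. ?m p + 1)" .
  obtain \<theta>1 \<theta>2 where part:
    "partition_of \<theta>1 (\<Sum>p\<in>S 2. ?m p)" "prod_list (map Suc \<theta>1) = (\<Prod>p\<in>S 2. ?m p + 1)"
    "partition_of \<theta>2 (\<Sum>p\<in>S 1. ?m p)" "prod_list (map Suc \<theta>2) = (\<Prod>p\<in>S 1. ?m p + 1)"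
    using partition_of_sum[of "S 2" ?m, OF fin pos[of _ 2]]
      partition_of_sum[of "S 1" ?m, OF fin pos[of _ 1]] by blast
  hence "card {d. d dvd f \<and> normalize d = d} = prod_list (map Suc (\<theta>1 @ \<theta>2))"
    by (simp add: card)
  with deg part(1,3) show ?thesis by blast
qed

text \<open>
  The parts of \<open>\<theta>1\<close> become exponents of the quadratics \<open>x\<^sup>2 + (i + 1)\<close>, those of \<open>\<theta>2\<close> exponents of
  the linear polynomials \<open>x - i\<close>. The part \<open>0\<close> of the partition \<open>[0]\<close> is an exponent \<open>0\<close>, which
  affects neither the polynomial nor the number of divisors.
\<close>
lemma partitions_imp_card_divisors:
  assumes "partition_of \<theta>1 r" "partition_of \<theta>2 s"
  shows "\<exists>f :: real poly. f \<noteq> 0 \<and> degree f = 2 * r + s \<and> finite {d. d dvd f \<and> normalize d = d} \<and>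
           card {d. d dvd f \<and> normalize d = d} = prod_list (map Suc (\<theta>1 @ \<theta>2))"
proof -
  let ?I = "{..<length \<theta>1} <+> {..<length \<theta>2}"
  define \<pi> :: "nat + nat \<Rightarrow> real poly"
    where "\<pi> = case_sum (\<lambda>i. [:real i + 1, 0, 1:]) (\<lambda>i. [:- real i, 1:])"
  define k where "k = case_sum ((!) \<theta>1) ((!) \<theta>2)"
  define f where "f = (\<Prod>i\<in>?I. \<pi> i ^ k i)"
  have inj: "inj \<pi>" by (auto simp: inj_def \<pi>_def split: sum.splits)
  have prime: "prime (\<pi> i)" for i
  proof (rule monic_real_poly_prime)
    show "lead_coeff (\<pi> i) = 1" by (simp add: \<pi>_def split: sum.splits)
    have "x * x + (real j + 1) \<noteq> 0" for x j
      using zero_le_square[of x] by (smt (verit) of_nat_0_le_iff)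
    thus "degree (\<pi> i) = 1 \<or> degree (\<pi> i) = 2 \<and> (\<forall>x. poly (\<pi> i) x \<noteq> 0)"
      by (auto simp: \<pi>_def add.commute split: sum.splits)
  qed
  hence nz: "\<pi> i \<noteq> 0" for i by (metis not_prime_0)
  have sum_k: "(\<Sum>i<length \<theta>. \<theta> ! i) = N" if "partition_of \<theta> N" for \<theta> N
    using that sum_list_sum_nth[of \<theta>]
    by (auto simp: partition_of_def atLeast0LessThan split: if_splits)
  have "degree f = (\<Sum>i\<in>?I. k i * degree (\<pi> i))"
    unfolding f_def using nz by (subst degree_prod_sum_eq) (auto simp: degree_power_eq)
  also have "\<dots> = 2 * (\<Sum>i<length \<theta>1. \<theta>1 ! i) + (\<Sum>i<length \<theta>2. \<theta>2 ! i)"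
    by (simp add: sum.Plus k_def \<pi>_def sum.distrib)
  finally have deg: "degree f = 2 * r + s" using assms sum_k by simp
  have reindex: "(\<Prod>p\<in>\<pi> ` ?I. h p) = (\<Prod>i\<in>?I. h (\<pi> i))" for h :: "real poly \<Rightarrow> 'b::comm_monoid_mult"
    using prod.reindex[OF inj_on_subset[OF inj subset_UNIV], of h ?I] by simp
  have f: "f = (\<Prod>p\<in>\<pi> ` ?I. p ^ k (inv \<pi> p))"
    by (simp only: f_def reindex inv_f_f[OF inj])
  have pr: "prime p" if "p \<in> \<pi> ` ?I" for p using that prime by blast
  have "card {d. d dvd f \<and> normalize d = d} = (\<Prod>p\<in>\<pi> ` ?I. k (inv \<pi> p) + 1)"
    unfolding f by (rule card_divisors_prod_prime_powers) (use pr in auto)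
  also have "\<dots> = (\<Prod>i\<in>?I. k i + 1)"
    by (simp only: reindex inv_f_f[OF inj])
  also have "\<dots> = prod_list (map Suc \<theta>1) * prod_list (map Suc \<theta>2)"
    by (simp add: prod.Plus k_def prod.list_conv_set_nth atLeast0LessThan)
  finally have "card {d. d dvd f \<and> normalize d = d} = prod_list (map Suc (\<theta>1 @ \<theta>2))" by simp
  moreover have "finite {d. d dvd f \<and> normalize d = d}"
    unfolding f by (rule card_divisors_prod_prime_powers) (use pr in auto)
  moreover have "f \<noteq> 0" using nz by (auto simp: f_def)
  ultimately show ?thesis using deg by blast
qed

section \<open>The possible numbers of invariant subspaces\<close>

lemma multipartition_pair:
  "multipartition [r, s] [\<theta>1, \<theta>2] \<longleftrightarrow> (r > 0 \<or> s > 0) \<and> partition_of \<theta>1 r \<and> partition_of \<theta>2 s"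
  by (auto simp: multipartition_def composition_def)

lemma prod_derived_composition:
  "(\<Prod>i<length (derived_composition \<mu> [\<theta>1, \<theta>2]). derived_composition \<mu> [\<theta>1, \<theta>2] ! i + 1)
     = prod_list (map Suc (\<theta>1 @ \<theta>2))"
  by (simp add: derived_composition_def prod.list_conv_set_nth atLeast0LessThan del: map_append)

theorem theorem3p7:
  fixes n :: nat
  assumes "n = CARD('n::finite)"
  shows "{m :: nat. m > 0 \<and> (\<exists>T :: real ^ 'n \<Rightarrow> real ^ 'n.
            linear T \<and> finite (invariant_subspaces T) \<and> card (invariant_subspaces T) = m)}
       = {\<Prod>i<length (derived_composition \<mu> \<theta>). (derived_composition \<mu> \<theta> ! i + 1) | r \<mu> \<theta> \<theta>1 \<theta>2.
            r \<le> n div 2 \<and> \<mu> = [r, n - 2 * r] \<and> \<theta> = [\<theta>1, \<theta>2] \<and> multipartition \<mu> \<theta>}"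
  (is "?A = ?B")
proof (intro equalityI subsetI)
  fix m assume "m \<in> ?A"
  then obtain T :: "real ^ 'n \<Rightarrow> real ^ 'n" where T: "linear T" "finite (invariant_subspaces T)"
    and m: "m = card (invariant_subspaces T)" by blast
  obtain ev f where pres: "cyclic_presentation ev T f"
    using cyclic_presentation_exists[OF T] by blast
  interpret cyclic_presentation ev T f by fact
  have deg: "degree f = n" using cyclic_presentation_degree[OF pres] assms by simp
  obtain r s \<theta>1 \<theta>2 where part: "degree f = 2 * r + s" "partition_of \<theta>1 r" "partition_of \<theta>2 s"
    and card: "card {d. d dvd f \<and> normalize d = d} = prod_list (map Suc (\<theta>1 @ \<theta>2))"
    using card_divisors_imp_partitions[OF f_nz] by blast
  have r: "r \<le> n div 2" and s: "n - 2 * r = s" using part deg by auto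
  \<comment> \<open>A composition contains at most one \<open>0\<close>, so \<open>r\<close> and \<open>s\<close> must not both vanish.\<close>
  have "n > 0" using assms by simp
  hence "multipartition [r, n - 2 * r] [\<theta>1, \<theta>2]"
    using part deg by (auto simp: multipartition_pair s)
  moreover have "m = prod_list (map Suc (\<theta>1 @ \<theta>2))"
    using bij_betw_same_card[OF bij_betw_divisors_invariant_subspaces] m card by simp
  ultimately show "m \<in> ?B"
    using r prod_derived_composition by (intro CollectI) metis
next
  fix m assume "m \<in> ?B"
  then obtain r \<theta>1 \<theta>2 where r: "r \<le> n div 2" and part: "multipartition [r, n - 2 * r] [\<theta>1, \<theta>2]"
    and "m = (\<Prod>i<length (derived_composition [r, n - 2 * r] [\<theta>1, \<theta>2]).
                derived_composition [r, n - 2 * r] [\<theta>1, \<theta>2] ! i + 1)"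
    by blast
  hence m: "m = prod_list (map Suc (\<theta>1 @ \<theta>2))" by (simp only: prod_derived_composition)
  obtain f :: "real poly" where f: "degree f = 2 * r + (n - 2 * r)"
    "finite {d. d dvd f \<and> normalize d = d}" "card {d. d dvd f \<and> normalize d = d} = m"
    using partitions_imp_card_divisors[of \<theta>1 r \<theta>2 "n - 2 * r"] part
    unfolding multipartition_pair m by blast
  have "degree f = CARD('n)" using f(1) r assms by simp
  then obtain ev and T :: "real ^ 'n \<Rightarrow> real ^ 'n" where T: "linear T" "cyclic_presentation ev T f"
    using cyclic_presentation_of_poly by blast
  note bij = cyclic_presentation.bij_betw_divisors_invariant_subspaces[OF T(2)]
  have "finite (invariant_subspaces T)" "card (invariant_subspaces T) = m"
    using bij_betw_finite[OF bij] bij_betw_same_card[OF bij] f by auto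
  moreover have "m > 0" unfolding m by (intro Nat.gr0I) (auto simp: prod_list_zero_iff)
  ultimately show "m \<in> ?A"
    using T(1) by blast
qed

end
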